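(* If $L$ is a pretransitive canonical normal modal logic, then for every $h\geq 1$ the logic $L[h]$ is canonical.
   Context: Modal formulas use variables, $\bot,\top$, Boolean connectives and unary $\Diamond$; $\Box\varphi=\neg\Diamond\neg\varphi$, $\Diamond^i,\Box^i$ are iterations, $\Diamond^{\le m}\varphi=\bigvee_{i=0}^m\Diamond^i\varphi$, $\Box^{\le m}\varphi=\bigwedge_{i=0}^m\Box^i\varphi$. A (normal) logic is a set of formulas containing all tautologies, $\neg\Diamond\bot$, $\Diamond(p_1\vee p_2)\to\Diamond p_1\vee\Diamond p_2$, closed under modus ponens, substitution and monotonicity (from $\varphi\to\psi$ infer $\Diamond\varphi\to\Diamond\psi$); $L+\Phi$ is the least logic containing $L\cup\Phi$. $L$ is pretransitive if it contains $\Diamond^{m+1}p\to\Diamond^{\le m}p$ for some $m\ge0$, and $\mathrm{tr}(L)$ is the least such $m$. $B_1(m)=p_1\to\Box^{\le m}\Diamond^{\le m}p_1$, $B_{h+1}(m)=p_{h+1}\to\Box^{\le m}(\Diamond^{\le m}p_{h+1}\vee B_h(m))$; $L[h]=L+\{B_h(\mathrm{tr}(L))\}$. For a consistent logic $L$ ($\bot\notin L$): a set $\Gamma$ of formulas is $L$-inconsistent if $\neg\bigwedge\Gamma_0\in L$ for some finite $\Gamma_0\subseteq\Gamma$, and $L$-maximal if it is $L$-consistent and every proper extension is $L$-inconsistent. The canonical frame of $L$ is $(W_L,R_L)$ where $W_L$ is the set of $L$-maximal sets and $\Gamma_1R_L\Gamma_2$ iff $\{\Diamond\varphi\mid\varphi\in\Gamma_2\}\subseteq\Gamma_1$.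 A logic is canonical if it is consistent and every formula of it is valid in its canonical frame (valid = true at every point under every valuation, with $\Diamond$ interpreted via the relation). *)

theory Defs
  imports Main
begin

datatype fm =
    Var nat
  | Bot
  | Top
  | Neg fm
  | And fm fm
  | Or fm fm
  | Imp fm fm
  | Dia fm

definition Box :: "fm \<Rightarrow> fm" where
  "Box \<phi> = Neg (Dia (Neg \<phi>))"

primrec dia_le :: "nat \<Rightarrow> fm \<Rightarrow> fm" where
  "dia_le 0 \<phi> = \<phi>"
| "dia_le (Suc m) \<phi> = Or (dia_le m \<phi>) ((Dia ^^ Suc m) \<phi>)"

primrec box_le :: "nat \<Rightarrow> fm \<Rightarrow> fm" where
  "box_le 0 \<phi> = \<phi>"
| "box_le (Suc m) \<phi> = And (box_le m \<phi>) ((Box ^^ Suc m) \<phi>)"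

primrec big_conj :: "fm list \<Rightarrow> fm" where
  "big_conj [] = Top"
| "big_conj (\<phi> # \<phi>s) = And \<phi> (big_conj \<phi>s)"

primrec subst :: "(nat \<Rightarrow> fm) \<Rightarrow> fm \<Rightarrow> fm" where
  "subst \<sigma> (Var n) = \<sigma> n"
| "subst \<sigma> Bot = Bot"
| "subst \<sigma> Top = Top"
| "subst \<sigma> (Neg \<phi>) = Neg (subst \<sigma> \<phi>)"
| "subst \<sigma> (And \<phi> \<psi>) = And (subst \<sigma> \<phi>) (subst \<sigma> \<psi>)"
| "subst \<sigma> (Or \<phi> \<psi>) = Or (subst \<sigma> \<phi>) (subst \<sigma> \<psi>)"
| "subst \<sigma> (Imp \<phi> \<psi>) = Imp (subst \<sigma> \<phi>) (subst \<sigma> \<psi>)"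
| "subst \<sigma> (Dia \<phi>) = Dia (subst \<sigma> \<phi>)"

text \<open>Variables and formulas of the form \<^term>\<open>Dia \<phi>\<close> are the propositional atoms, so that
  a tautology here is an instance of a classical propositional tautology.  Since logics are closed
  under substitution, this yields the same logics as using tautologies without modalities.\<close>

primrec prop_eval :: "(fm \<Rightarrow> bool) \<Rightarrow> fm \<Rightarrow> bool" where
  "prop_eval v (Var n) = v (Var n)"
| "prop_eval v Bot = False"
| "prop_eval v Top = True"
| "prop_eval v (Neg \<phi>) = (\<not> prop_eval v \<phi>)"
| "prop_eval v (And \<phi> \<psi>) = (prop_eval v \<phi> \<and> prop_eval v \<psi>)"
| "prop_eval v (Or \<phi> \<psi>) = (prop_eval v \<phi> \<or> prop_eval v \<psi>)"
| "prop_eval v (Imp \<phi> \<psi>) = (prop_eval v \<phi> \<longrightarrow> prop_eval v \<psi>)"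
| "prop_eval v (Dia \<phi>) = v (Dia \<phi>)"

definition tautology :: "fm \<Rightarrow> bool" where
  "tautology \<phi> \<longleftrightarrow> (\<forall>v. prop_eval v \<phi>)"

definition normal_logic :: "fm set \<Rightarrow> bool" where
  "normal_logic L \<longleftrightarrow>
     (\<forall>\<phi>. tautology \<phi> \<longrightarrow> \<phi> \<in> L) \<and>
     Neg (Dia Bot) \<in> L \<and>
     Imp (Dia (Or (Var 1) (Var 2))) (Or (Dia (Var 1)) (Dia (Var 2))) \<in> L \<and>
     (\<forall>\<phi> \<psi>. \<phi> \<in> L \<longrightarrow> Imp \<phi> \<psi> \<in> L \<longrightarrow> \<psi> \<in> L) \<and>
     (\<forall>\<phi> \<sigma>. \<phi> \<in> L \<longrightarrow> subst \<sigma> \<phi> \<in> L) \<and>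
     (\<forall>\<phi> \<psi>. Imp \<phi> \<psi> \<in> L \<longrightarrow> Imp (Dia \<phi>) (Dia \<psi>) \<in> L)"

definition logic_sum :: "fm set \<Rightarrow> fm set \<Rightarrow> fm set" where
  "logic_sum L \<Phi> = \<Inter> {L'. normal_logic L' \<and> L \<union> \<Phi> \<subseteq> L'}"

lemma normal_logic_logic_sum: "normal_logic (logic_sum L \<Phi>)"
  unfolding logic_sum_def normal_logic_def by blast

lemma logic_sum_upper: "L \<union> \<Phi> \<subseteq> logic_sum L \<Phi>"
  unfolding logic_sum_def by blast

lemma logic_sum_least: "normal_logic L' \<Longrightarrow> L \<union> \<Phi> \<subseteq> L' \<Longrightarrow> logic_sum L \<Phi> \<subseteq> L'"
  unfolding logic_sum_def by blast

definition transitivity_ax :: "nat \<Rightarrow> fm" where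
  "transitivity_ax m = Imp ((Dia ^^ (m + 1)) (Var 1)) (dia_le m (Var 1))"

definition pretransitive :: "fm set \<Rightarrow> bool" where
  "pretransitive L \<longleftrightarrow> (\<exists>m. transitivity_ax m \<in> L)"

definition tr :: "fm set \<Rightarrow> nat" where
  "tr L = (LEAST m. transitivity_ax m \<in> L)"

text \<open>\<open>height_ax h m\<close> is the formula $B_h(m)$, meaningful for \<open>h \<ge> 1\<close> only; the first
  equation is a dummy.\<close>

fun height_ax :: "nat \<Rightarrow> nat \<Rightarrow> fm" where
  "height_ax 0 m = Bot"
| "height_ax (Suc 0) m = Imp (Var 1) (box_le m (dia_le m (Var 1)))"
| "height_ax (Suc (Suc h)) m =
     Imp (Var (Suc (Suc h)))
       (box_le m (Or (dia_le m (Var (Suc (Suc h)))) (height_ax (Suc h) m)))"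

definition logic_height :: "fm set \<Rightarrow> nat \<Rightarrow> fm set" where
  "logic_height L h = logic_sum L {height_ax h (tr L)}"

primrec sat :: "'w set \<Rightarrow> ('w \<times> 'w) set \<Rightarrow> (nat \<Rightarrow> 'w set) \<Rightarrow> 'w \<Rightarrow> fm \<Rightarrow> bool" where
  "sat W R V w (Var n) = (w \<in> V n)"
| "sat W R V w Bot = False"
| "sat W R V w Top = True"
| "sat W R V w (Neg \<phi>) = (\<not> sat W R V w \<phi>)"
| "sat W R V w (And \<phi> \<psi>) = (sat W R V w \<phi> \<and> sat W R V w \<psi>)"
| "sat W R V w (Or \<phi> \<psi>) = (sat W R V w \<phi> \<or> sat W R V w \<psi>)"
| "sat W R V w (Imp \<phi> \<psi>) = (sat W R V w \<phi> \<longrightarrow> sat W R V w \<psi>)"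
| "sat W R V w (Dia \<phi>) = (\<exists>u\<in>W. (w, u) \<in> R \<and> sat W R V u \<phi>)"

definition valid :: "'w set \<Rightarrow> ('w \<times> 'w) set \<Rightarrow> fm \<Rightarrow> bool" where
  "valid W R \<phi> \<longleftrightarrow> (\<forall>V. (\<forall>n. V n \<subseteq> W) \<longrightarrow> (\<forall>w\<in>W. sat W R V w \<phi>))"

definition consistent_logic :: "fm set \<Rightarrow> bool" where
  "consistent_logic L \<longleftrightarrow> Bot \<notin> L"

text \<open>The conjunction over a finite subset is taken along an arbitrary enumeration of it.\<close>

definition inconsistent :: "fm set \<Rightarrow> fm set \<Rightarrow> bool" where
  "inconsistent L \<Gamma> \<longleftrightarrow> (\<exists>\<phi>s. set \<phi>s \<subseteq> \<Gamma> \<and> Neg (big_conj \<phi>s) \<in> L)"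

definition maximal :: "fm set \<Rightarrow> fm set \<Rightarrow> bool" where
  "maximal L \<Gamma> \<longleftrightarrow> \<not> inconsistent L \<Gamma> \<and> (\<forall>\<Delta>. \<Gamma> \<subset> \<Delta> \<longrightarrow> inconsistent L \<Delta>)"

definition canonical_worlds :: "fm set \<Rightarrow> fm set set" where
  "canonical_worlds L = {\<Gamma>. maximal L \<Gamma>}"

definition canonical_rel :: "fm set \<Rightarrow> (fm set \<times> fm set) set" where
  "canonical_rel L =
     {(\<Gamma>\<^sub>1, \<Gamma>\<^sub>2) \<in> canonical_worlds L \<times> canonical_worlds L. Dia ` \<Gamma>\<^sub>2 \<subseteq> \<Gamma>\<^sub>1}"

definition canonical :: "fm set \<Rightarrow> bool" where
  "canonical L \<longleftrightarrow>
     consistent_logic L \<and> (\<forall>\<phi>\<in>L. valid (canonical_worlds L) (canonical_rel L) \<phi>)"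

end

theory Submission
  imports Defs
begin

text \<open>Validity of \<open>B\<^sub>h\<close>: if \<open>B\<^sub>h(m)\<close> fails at a world \<open>\<Gamma>\<close> of the
  canonical frame of \<open>L[h]\<close> under some valuation, there is a chain of worlds from \<open>\<Gamma>\<close> each
  of which is not seen in at most \<open>m\<close> steps by the next one. Maximal sets that do not see each
  other in at most \<open>m\<close> steps are separated by a formula, and substituting these formulas for the
  variables yields an instance of \<open>B\<^sub>h(m)\<close> missing from \<open>\<Gamma>\<close>, which is absurd. Formulas of
  \<open>L\<close> remain valid because the canonical frame of \<open>L[h]\<close> is a generated subframe of that
  of \<open>L\<close>.

  Consistency: take a set of formulas \<open>\<box>\<^sup>\<le>\<^sup>m\<psi>\<close> that is maximal among the
  \<open>L\<close>-consistent ones. The worlds containing it form a generated subframe in which any two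
  worlds see each other in at most \<open>m\<close> steps, so that this frame validates \<open>L\<close> and
  every \<open>B\<^sub>h(m)\<close>.\<close>

section \<open>Frames\<close>

lemma sat_Dia_pow:
  assumes "R \<subseteq> W \<times> W" "w \<in> W"
  shows "sat W R V w ((Dia ^^ i) \<phi>) \<longleftrightarrow> (\<exists>u. (w, u) \<in> R ^^ i \<and> sat W R V u \<phi>)"
  using assms(2)
proof (induction i arbitrary: w)
  case (Suc i)
  have "sat W R V w ((Dia ^^ Suc i) \<phi>) \<longleftrightarrow>
      (\<exists>u. (w, u) \<in> R \<and> sat W R V u ((Dia ^^ i) \<phi>))"
    using assms(1) by auto
  also have "\<dots> \<longleftrightarrow> (\<exists>u v. (w, u) \<in> R \<and> (u, v) \<in> R ^^ i \<and> sat W R V v \<phi>)"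
    using Suc.IH assms(1) by blast
  also have "\<dots> \<longleftrightarrow> (\<exists>v. (w, v) \<in> R ^^ Suc i \<and> sat W R V v \<phi>)"
    by (meson relpow_Suc_E2 relpow_Suc_I2)
  finally show ?case .
qed auto

lemma sat_Box_pow:
  assumes "R \<subseteq> W \<times> W" "w \<in> W"
  shows "sat W R V w ((Box ^^ i) \<phi>) \<longleftrightarrow> (\<forall>u. (w, u) \<in> R ^^ i \<longrightarrow> sat W R V u \<phi>)"
  using assms(2)
proof (induction i arbitrary: w)
  case (Suc i)
  have "sat W R V w ((Box ^^ Suc i) \<phi>) \<longleftrightarrow>
      (\<forall>u. (w, u) \<in> R \<longrightarrow> sat W R V u ((Box ^^ i) \<phi>))"
    using assms(1) by (auto simp: Box_def)
  also have "\<dots> \<longleftrightarrow> (\<forall>u v. (w, u) \<in> R \<longrightarrow> (u, v) \<in> R ^^ i \<longrightarrow> sat W R V v \<phi>)"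
    using Suc.IH assms(1) by blast
  also have "\<dots> \<longleftrightarrow> (\<forall>v. (w, v) \<in> R ^^ Suc i \<longrightarrow> sat W R V v \<phi>)"
    by (meson relpow_Suc_E2 relpow_Suc_I2)
  finally show ?case .
qed auto

lemma sat_dia_le:
  assumes "R \<subseteq> W \<times> W" "w \<in> W"
  shows "sat W R V w (dia_le m \<phi>) \<longleftrightarrow>
    (\<exists>i\<le>m. \<exists>u. (w, u) \<in> R ^^ i \<and> sat W R V u \<phi>)"
proof -
  have "sat W R V w (dia_le m \<phi>) \<longleftrightarrow> (\<exists>i\<le>m. sat W R V w ((Dia ^^ i) \<phi>))"
    by (induction m) (auto simp: le_Suc_eq simp del: funpow.simps(2))
  then show ?thesis
    using sat_Dia_pow[OF assms] by simp
qed

lemma sat_box_le: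
  assumes "R \<subseteq> W \<times> W" "w \<in> W"
  shows "sat W R V w (box_le m \<phi>) \<longleftrightarrow>
    (\<forall>i\<le>m. \<forall>u. (w, u) \<in> R ^^ i \<longrightarrow> sat W R V u \<phi>)"
proof -
  have "sat W R V w (box_le m \<phi>) \<longleftrightarrow> (\<forall>i\<le>m. sat W R V w ((Box ^^ i) \<phi>))"
    by (induction m) (auto simp: le_Suc_eq simp del: funpow.simps(2))
  then show ?thesis
    using sat_Box_pow[OF assms] by simp
qed

lemma relpow_closed:
  assumes "R \<subseteq> W \<times> W" "w \<in> W" "(w, u) \<in> R ^^ i"
  shows "u \<in> W"
  using assms(2,3)
  by (induction i arbitrary: u) (use assms(1) in auto)

section \<open>Substitution, soundness and generated subframes\<close>

lemma sat_subst:
  assumes "w \<in> W"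
  shows "sat W R V w (subst \<sigma> \<phi>) \<longleftrightarrow>
    sat W R (\<lambda>n. {u \<in> W. sat W R V u (\<sigma> n)}) w \<phi>"
  using assms by (induction \<phi> arbitrary: w) auto

lemma subst_Dia_pow: "subst \<sigma> ((Dia ^^ k) \<phi>) = (Dia ^^ k) (subst \<sigma> \<phi>)"
  by (induction k) auto

lemma subst_Box_pow: "subst \<sigma> ((Box ^^ k) \<phi>) = (Box ^^ k) (subst \<sigma> \<phi>)"
  by (induction k) (auto simp: Box_def)

lemma subst_dia_le: "subst \<sigma> (dia_le m \<phi>) = dia_le m (subst \<sigma> \<phi>)"
  by (induction m) (auto simp: subst_Dia_pow simp del: funpow.simps)

lemma subst_box_le: "subst \<sigma> (box_le m \<phi>) = box_le m (subst \<sigma> \<phi>)"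
  by (induction m) (auto simp: subst_Box_pow simp del: funpow.simps)

text \<open>Truth at a fixed world is a valuation of the propositional atoms, \<open>Dia\<close>
  formulas included; hence tautologies hold at every world.\<close>

lemma sat_prop_eval: "sat W R V w \<phi> \<longleftrightarrow> prop_eval (sat W R V w) \<phi>"
  by (induction \<phi>) auto

text \<open>Soundness: combined with \<open>logic_sum_least\<close>, it reduces validity of a whole
  logic to validity of its generators.\<close>

lemma normal_logic_valid: "normal_logic {\<phi>. valid W R \<phi>}"
proof -
  have "valid W R \<phi>" if "tautology \<phi>" for \<phi>
    using that unfolding valid_def tautology_def by (metis sat_prop_eval)
  moreover have "valid W R (subst \<sigma> \<phi>)" if "valid W R \<phi>" for \<phi> \<sigma>
    using that unfolding valid_def by (auto simp: sat_subst)
  ultimately show ?thesis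
    unfolding normal_logic_def by (auto simp: valid_def)
qed

text \<open>Truth at a point depends only on points reachable from it, and these stay in
  \<open>W'\<close>. Since \<open>R'\<close> is compared with \<open>R\<close> on \<open>W'\<close>
  only, it may be a relation defined independently of \<open>R\<close>.\<close>

lemma valid_generated_subframe:
  assumes "valid W R \<phi>" "W' \<subseteq> W"
    and "\<And>w u. w \<in> W' \<Longrightarrow> u \<in> W \<Longrightarrow> (w, u) \<in> R \<Longrightarrow> u \<in> W'"
    and "\<And>w u. w \<in> W' \<Longrightarrow> u \<in> W' \<Longrightarrow> (w, u) \<in> R' \<longleftrightarrow> (w, u) \<in> R"
  shows "valid W' R' \<phi>"
proof -
  have "sat W' R' V w \<psi> \<longleftrightarrow> sat W R V w \<psi>" if "w \<in> W'" for V w \<psi>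
    using that
  proof (induction \<psi> arbitrary: w)
    case (Dia \<psi>)
    then show ?case
      using assms(2-4) by (auto 0 3)
  qed auto
  then show ?thesis
    using assms(1,2) unfolding valid_def by blast
qed

text \<open>For \<open>h = 1\<close> every point reached has a short path back. For larger
  \<open>h\<close> the disjunct with the preceding axiom already holds everywhere, by
  induction.\<close>

lemma height_ax_valid:
  assumes "R \<subseteq> W \<times> W" "h \<ge> 1"
    and "\<And>w u. w \<in> W \<Longrightarrow> u \<in> W \<Longrightarrow> \<exists>i\<le>m. (w, u) \<in> R ^^ i"
  shows "valid W R (height_ax h m)"
proof -
  have "sat W R V w (height_ax h m)" if "w \<in> W" for V w
    using assms(2,3) that
  proof (induction h m arbitrary: w rule: height_ax.induct)
    case (2 m)
    have "sat W R V u (dia_le m (Var 1))" if "w \<in> V 1" "(w, u) \<in> R ^^ i" for i u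
    proof -
      have "u \<in> W"
        using relpow_closed[OF assms(1) "2.prems"(3) that(2)] .
      then obtain j where j: "j \<le> m" "(u, w) \<in> R ^^ j"
        using "2.prems"(2)[of u w] "2.prems"(3) by blast
      have "sat W R V w (Var 1)"
        using that(1) by simp
      then show ?thesis
        using j sat_dia_le[OF assms(1) \<open>u \<in> W\<close>] by metis
    qed
    then show ?case
      using 2 by (simp add: sat_box_le[OF assms(1)])
  next
    case (3 h m)
    then show ?case
      using relpow_closed[OF assms(1)] by (auto simp: sat_box_le[OF assms(1)])
  qed auto
  then show ?thesis
    unfolding valid_def by blast
qed

section \<open>Maximal sets\<close>

lemma prop_eval_big_conj: "prop_eval v (big_conj \<phi>s) \<longleftrightarrow> (\<forall>\<phi>\<in>set \<phi>s. prop_eval v \<phi>)"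
  by (induction \<phi>s) auto

text \<open>Zorn's lemma applies because an inconsistency involves finitely many formulas and so
  arises within one member of a chain. With \<open>B\<close> the set of all formulas this is the
  usual Lindenbaum lemma; with \<open>B\<close> the range of \<open>box_le m\<close> it supplies the
  set that defines a single cluster in the consistency proof.\<close>

lemma lindenbaum_within:
  assumes "S \<subseteq> B" "\<not> inconsistent L S"
  obtains M where "S \<subseteq> M" "M \<subseteq> B" "\<not> inconsistent L M"
    "\<And>\<Delta>. \<Delta> \<subseteq> B \<Longrightarrow> M \<subset> \<Delta> \<Longrightarrow> inconsistent L \<Delta>"
proof -
  define A where "A = {X. S \<subseteq> X \<and> X \<subseteq> B \<and> \<not> inconsistent L X}"
  have "\<exists>M\<in>A. \<forall>X\<in>A. M \<subseteq> X \<longrightarrow> X = M"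
  proof (rule subset_Zorn_nonempty)
    show "A \<noteq> {}"
      using assms unfolding A_def by blast
    fix C assume C: "C \<noteq> {}" "subset.chain A C"
    have "\<not> inconsistent L (\<Union>C)"
    proof
      assume "inconsistent L (\<Union>C)"
      then obtain \<phi>s where \<phi>s: "set \<phi>s \<subseteq> \<Union>C" "Neg (big_conj \<phi>s) \<in> L"
        unfolding inconsistent_def by blast
      then obtain X where "X \<in> C" "set \<phi>s \<subseteq> X"
        using finite_subset_Union_chain[OF _ \<phi>s(1) C] by blast
      then show False
        using \<phi>s(2) C(2) unfolding A_def subset.chain_def inconsistent_def by blast
    qed
    then show "\<Union>C \<in> A"
      using C unfolding A_def subset.chain_def by blast
  qed
  then obtain M where M: "M \<in> A" "\<And>X. X \<in> A \<Longrightarrow> M \<subseteq> X \<Longrightarrow> X = M"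
    by blast
  show thesis
  proof (rule that[of M])
    show "inconsistent L \<Delta>" if "\<Delta> \<subseteq> B" "M \<subset> \<Delta>" for \<Delta>
    proof (rule ccontr)
      assume "\<not> inconsistent L \<Delta>"
      then have "\<Delta> \<in> A"
        using that M(1) unfolding A_def by blast
      then show False
        using that(2) M(2) by blast
    qed
  qed (use M in \<open>auto simp: A_def\<close>)
qed

lemma lindenbaum:
  assumes "\<not> inconsistent L S"
  obtains \<Gamma> where "S \<subseteq> \<Gamma>" "maximal L \<Gamma>"
proof (rule lindenbaum_within[of S UNIV L])
  fix M
  assume "S \<subseteq> M" "\<not> inconsistent L M"
    "\<And>\<Delta>. \<Delta> \<subseteq> UNIV \<Longrightarrow> M \<subset> \<Delta> \<Longrightarrow> inconsistent L \<Delta>"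
  then show thesis
    using that unfolding maximal_def by simp
qed (use assms in auto)

section \<open>Propositional reasoning in a logic and in its maximal sets\<close>

locale normal_modal_logic =
  fixes L :: "fm set"
  assumes L: "normal_logic L"
begin

text \<open>Moving the premises one by one into implications leaves a tautology, and modus ponens
  removes them again. Propositional derivations thereby become checks with
  \<open>prop_eval\<close>.\<close>

lemma logic_consequence:
  assumes "set \<phi>s \<subseteq> L" "\<And>v. \<forall>\<phi>\<in>set \<phi>s. prop_eval v \<phi> \<Longrightarrow> prop_eval v \<psi>"
  shows "\<psi> \<in> L"
  using assms
proof (induction \<phi>s arbitrary: \<psi>)
  case Nil
  then show ?case
    using L unfolding normal_logic_def tautology_def by simp
next
  case (Cons \<phi> \<phi>s)
  have "Imp \<phi> \<psi> \<in> L"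
    by (rule Cons.IH) (use Cons.prems in auto)
  moreover have "\<phi> \<in> L"
    using Cons.prems(1) by simp
  ultimately show ?case
    using L unfolding normal_logic_def by blast
qed

lemma logic_Dia_mono: "Imp \<phi> \<psi> \<in> L \<Longrightarrow> Imp (Dia \<phi>) (Dia \<psi>) \<in> L"
  using L unfolding normal_logic_def by blast

lemma logic_subst: "\<phi> \<in> L \<Longrightarrow> subst \<sigma> \<phi> \<in> L"
  using L unfolding normal_logic_def by blast

lemma logic_Dia_Or: "Imp (Dia (Or \<phi> \<psi>)) (Or (Dia \<phi>) (Dia \<psi>)) \<in> L"
proof -
  have "subst (\<lambda>n. if n = 1 then \<phi> else \<psi>)
      (Imp (Dia (Or (Var 1) (Var 2))) (Or (Dia (Var 1)) (Dia (Var 2)))) \<in> L"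
    using L logic_subst unfolding normal_logic_def by blast
  then show ?thesis
    by simp
qed

text \<open>If \<open>\<psi>\<close> were missing, it would occur in a refutation together with
  members of \<Gamma>; replacing it there by the premises that imply it would refute \<Gamma>
  itself.\<close>

lemma maximal_consequence:
  assumes "maximal L \<Gamma>" "set \<phi>s \<subseteq> L \<union> \<Gamma>"
    and "\<And>v. \<forall>\<phi>\<in>set \<phi>s. prop_eval v \<phi> \<Longrightarrow> prop_eval v \<psi>"
  shows "\<psi> \<in> \<Gamma>"
proof (rule ccontr)
  assume "\<psi> \<notin> \<Gamma>"
  then have "inconsistent L (insert \<psi> \<Gamma>)"
    using assms(1) unfolding maximal_def by blast
  then obtain \<chi>s where \<chi>s: "set \<chi>s \<subseteq> insert \<psi> \<Gamma>" "Neg (big_conj \<chi>s) \<in> L"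
    unfolding inconsistent_def by blast
  \<comment> \<open>The filter drops \<open>\<psi>\<close> from \<open>\<chi>s\<close>; the premises
    it drops from \<open>\<phi>s\<close> lie in \<open>L\<close> and are kept in
    \<open>?ls\<close>.\<close>
  let ?\<theta>s = "filter (\<lambda>\<phi>. \<phi> \<in> \<Gamma>) (\<phi>s @ \<chi>s)"
  let ?ls = "Neg (big_conj \<chi>s) # filter (\<lambda>\<phi>. \<phi> \<in> L) \<phi>s"
  have "Neg (big_conj ?\<theta>s) \<in> L"
  proof (rule logic_consequence[of ?ls])
    fix v assume v: "\<forall>\<phi>\<in>set ?ls. prop_eval v \<phi>"
    show "prop_eval v (Neg (big_conj ?\<theta>s))"
    proof (rule ccontr)
      assume "\<not> prop_eval v (Neg (big_conj ?\<theta>s))"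
      then have \<theta>s: "\<forall>\<phi>\<in>set ?\<theta>s. prop_eval v \<phi>"
        by (simp add: prop_eval_big_conj)
      then have "prop_eval v \<psi>"
        using v assms(2) by (intro assms(3)) auto
      then show False
        using v \<theta>s \<chi>s(1) by (auto simp: prop_eval_big_conj)
    qed
  qed (use \<chi>s in auto)
  then have "inconsistent L \<Gamma>"
    unfolding inconsistent_def by (intro exI[of _ ?\<theta>s]) auto
  then show False
    using assms(1) unfolding maximal_def by blast
qed

lemma maximal_superset: "maximal L \<Gamma> \<Longrightarrow> L \<subseteq> \<Gamma>"
  using maximal_consequence[of \<Gamma> "[\<phi>]" \<phi> for \<phi>] by auto

lemma maximal_mp: "maximal L \<Gamma> \<Longrightarrow> Imp \<phi> \<psi> \<in> L \<union> \<Gamma> \<Longrightarrow> \<phi> \<in> \<Gamma> \<Longrightarrow> \<psi> \<in> \<Gamma>"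
  by (rule maximal_consequence[of \<Gamma> "[Imp \<phi> \<psi>, \<phi>]"]) auto

lemma inconsistent_complement:
  assumes "\<phi> \<in> \<Gamma>" "Neg \<phi> \<in> \<Gamma>"
  shows "inconsistent L \<Gamma>"
proof -
  have "Neg (big_conj [\<phi>, Neg \<phi>]) \<in> L"
    by (rule logic_consequence[of "[]"]) auto
  then show ?thesis
    using assms unfolding inconsistent_def by (intro exI[of _ "[\<phi>, Neg \<phi>]"]) auto
qed

lemma maximal_Neg:
  assumes "maximal L \<Gamma>"
  shows "Neg \<phi> \<in> \<Gamma> \<longleftrightarrow> \<phi> \<notin> \<Gamma>"
proof
  show "\<phi> \<notin> \<Gamma>" if "Neg \<phi> \<in> \<Gamma>"
    using that assms inconsistent_complement unfolding maximal_def by blast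
  show "Neg \<phi> \<in> \<Gamma>" if "\<phi> \<notin> \<Gamma>"
  proof -
    have "inconsistent L (insert \<phi> \<Gamma>)"
      using that assms unfolding maximal_def by blast
    then obtain \<chi>s where \<chi>s: "set \<chi>s \<subseteq> insert \<phi> \<Gamma>" "Neg (big_conj \<chi>s) \<in> L"
      unfolding inconsistent_def by blast
    show ?thesis
      by (rule maximal_consequence[OF assms, of "Neg (big_conj \<chi>s) # filter (\<lambda>\<chi>. \<chi> \<noteq> \<phi>) \<chi>s"])
        (use \<chi>s in \<open>auto simp: prop_eval_big_conj\<close>)
  qed
qed

text \<open>Here the logic enters through consistency alone, so maximality can be compared between a
  logic and its extension.\<close>

lemma maximal_iff:
  "maximal L \<Gamma> \<longleftrightarrow> \<not> inconsistent L \<Gamma> \<and> (\<forall>\<phi>. \<phi> \<in> \<Gamma> \<or> Neg \<phi> \<in> \<Gamma>)"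
proof
  assume "\<not> inconsistent L \<Gamma> \<and> (\<forall>\<phi>. \<phi> \<in> \<Gamma> \<or> Neg \<phi> \<in> \<Gamma>)"
  then show "maximal L \<Gamma>"
    using inconsistent_complement unfolding maximal_def by blast
qed (use maximal_Neg in \<open>auto simp: maximal_def\<close>)

lemma maximal_big_conj:
  assumes "maximal L \<Gamma>"
  shows "big_conj \<phi>s \<in> \<Gamma> \<longleftrightarrow> set \<phi>s \<subseteq> \<Gamma>"
proof
  show "big_conj \<phi>s \<in> \<Gamma>" if "set \<phi>s \<subseteq> \<Gamma>"
    by (rule maximal_consequence[OF assms, of \<phi>s]) (use that in \<open>auto simp: prop_eval_big_conj\<close>)
  show "set \<phi>s \<subseteq> \<Gamma>" if "big_conj \<phi>s \<in> \<Gamma>"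
  proof
    fix \<phi> assume "\<phi> \<in> set \<phi>s"
    then show "\<phi> \<in> \<Gamma>"
      using that
      by (intro maximal_consequence[OF assms, of "[big_conj \<phi>s]"]) (auto simp: prop_eval_big_conj)
  qed
qed

lemma maximal_Dia_Bot: "maximal L \<Gamma> \<Longrightarrow> Dia Bot \<notin> \<Gamma>"
  using L maximal_superset maximal_Neg unfolding normal_logic_def by blast

lemma maximal_Dia_Or:
  assumes "maximal L \<Gamma>" "Dia (Or \<phi> \<psi>) \<in> \<Gamma>"
  shows "Dia \<phi> \<in> \<Gamma> \<or> Dia \<psi> \<in> \<Gamma>"
proof (rule ccontr)
  assume "\<not> ?thesis"
  then have "Bot \<in> \<Gamma>"
    using assms maximal_Neg[OF assms(1)] logic_Dia_Or[of \<phi> \<psi>]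
    by (intro maximal_consequence[OF assms(1), of "[Dia (Or \<phi> \<psi>), Neg (Dia \<phi>), Neg (Dia \<psi>),
        Imp (Dia (Or \<phi> \<psi>)) (Or (Dia \<phi>) (Dia \<psi>))]"]) auto
  then have "Dia \<phi> \<in> \<Gamma>"
    by (intro maximal_consequence[OF assms(1), of "[Bot]"]) auto
  with \<open>\<not> ?thesis\<close> show False
    by blast
qed

section \<open>The canonical model\<close>

text \<open>A successor must contain \<open>Neg \<psi>\<close> whenever \<open>Dia \<psi>\<close> is
  not in \<Gamma>. Adding these formulas to \<open>S\<close> is consistent, since otherwise some
  finite conjunction from \<open>S\<close> would imply such a \<open>\<psi>\<close>. The set
  \<open>S\<close> may be infinite, as the construction of paths requires.\<close>

lemma canonical_successor:
  assumes "maximal L \<Gamma>" and S: "\<And>\<chi>s. set \<chi>s \<subseteq> S \<Longrightarrow> Dia (big_conj \<chi>s) \<in> \<Gamma>"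
  obtains \<Delta> where "S \<subseteq> \<Delta>" "(\<Gamma>, \<Delta>) \<in> canonical_rel L"
proof -
  define T where "T = S \<union> Neg ` {\<psi>. Dia \<psi> \<notin> \<Gamma>}"
  \<comment> \<open>All negated formulas in the list are collected into one disjunction
    \<open>\<psi>\<close>, starting from \<open>Bot\<close>; \<open>Dia\<close> distributes over
    \<open>Or\<close>, so \<open>Dia \<psi>\<close> stays outside \<Gamma>.\<close>
  have split: "\<exists>\<chi>s \<psi>. set \<chi>s \<subseteq> S \<and> Dia \<psi> \<notin> \<Gamma> \<and>
      (\<forall>v. prop_eval v (big_conj \<chi>s) \<and> \<not> prop_eval v \<psi> \<longrightarrow> prop_eval v (big_conj \<phi>s))"
    if "set \<phi>s \<subseteq> T" for \<phi>s
    using that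
  proof (induction \<phi>s)
    case Nil
    then show ?case
      using maximal_Dia_Bot[OF assms(1)] by (intro exI[of _ "[]"] exI[of _ Bot]) auto
  next
    case (Cons \<phi> \<phi>s)
    then obtain \<chi>s \<psi> where *: "set \<chi>s \<subseteq> S" "Dia \<psi> \<notin> \<Gamma>"
      "\<And>v. prop_eval v (big_conj \<chi>s) \<Longrightarrow> \<not> prop_eval v \<psi> \<Longrightarrow> prop_eval v (big_conj \<phi>s)"
      by auto
    show ?case
    proof (cases "\<phi> \<in> S")
      case True
      then show ?thesis
        using * by (intro exI[of _ "\<phi> # \<chi>s"] exI[of _ \<psi>]) auto
    next
      case False
      then obtain \<theta> where \<theta>: "\<phi> = Neg \<theta>" "Dia \<theta> \<notin> \<Gamma>"
        using Cons.prems unfolding T_def by auto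
      then show ?thesis
        using * maximal_Dia_Or[OF assms(1)]
        by (intro exI[of _ \<chi>s] exI[of _ "Or \<theta> \<psi>"]) auto
    qed
  qed
  have "\<not> inconsistent L T"
  proof
    assume "inconsistent L T"
    then obtain \<phi>s where \<phi>s: "set \<phi>s \<subseteq> T" "Neg (big_conj \<phi>s) \<in> L"
      unfolding inconsistent_def by blast
    then obtain \<chi>s \<psi> where *: "set \<chi>s \<subseteq> S" "Dia \<psi> \<notin> \<Gamma>"
      "\<And>v. prop_eval v (big_conj \<chi>s) \<Longrightarrow> \<not> prop_eval v \<psi> \<Longrightarrow> prop_eval v (big_conj \<phi>s)"
      using split by blast
    then have "Imp (big_conj \<chi>s) \<psi> \<in> L"
      using \<phi>s(2) by (intro logic_consequence[of "[Neg (big_conj \<phi>s)]"]) auto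
    then have "Dia \<psi> \<in> \<Gamma>"
      using S[OF *(1)] logic_Dia_mono maximal_mp[OF assms(1)] by blast
    with *(2) show False
      by blast
  qed
  then obtain \<Delta> where \<Delta>: "T \<subseteq> \<Delta>" "maximal L \<Delta>"
    by (rule lindenbaum)
  then have "Dia ` \<Delta> \<subseteq> \<Gamma>"
    using maximal_Neg[OF \<Delta>(2)] unfolding T_def by blast
  then show thesis
    using that \<Delta> assms(1) unfolding T_def canonical_rel_def canonical_worlds_def by blast
qed

abbreviation canonical_sat :: "fm set \<Rightarrow> fm \<Rightarrow> bool" where
  "canonical_sat \<equiv> sat (canonical_worlds L) (canonical_rel L) (\<lambda>n. {\<Gamma>. Var n \<in> \<Gamma>})"

lemma truth_lemma:
  assumes "maximal L \<Gamma>"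
  shows "canonical_sat \<Gamma> \<phi> \<longleftrightarrow> \<phi> \<in> \<Gamma>"
  using assms
proof (induction \<phi> arbitrary: \<Gamma>)
  case Bot
  then show ?case
    using maximal_Neg[OF Bot, of Bot] maximal_consequence[OF Bot, of "[]" "Neg Bot"] by auto
next
  case Top
  then show ?case
    using maximal_consequence[OF Top, of "[]" Top] by auto
next
  case (Neg \<phi>)
  then show ?case
    using maximal_Neg by auto
next
  case (And \<phi> \<psi>)
  have "\<phi> \<in> \<Gamma>" "\<psi> \<in> \<Gamma>" if "And \<phi> \<psi> \<in> \<Gamma>"
    by (rule maximal_consequence[OF And.prems, of "[And \<phi> \<psi>]"]; use that in simp)+
  moreover have "And \<phi> \<psi> \<in> \<Gamma>" if "\<phi> \<in> \<Gamma>" "\<psi> \<in> \<Gamma>"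
    by (rule maximal_consequence[OF And.prems, of "[\<phi>, \<psi>]"]) (use that in simp_all)
  ultimately have "And \<phi> \<psi> \<in> \<Gamma> \<longleftrightarrow> \<phi> \<in> \<Gamma> \<and> \<psi> \<in> \<Gamma>"
    by blast
  with And show ?case
    by auto
next
  case (Or \<phi> \<psi>)
  have "Or \<phi> \<psi> \<in> \<Gamma> \<longleftrightarrow> \<phi> \<in> \<Gamma> \<or> \<psi> \<in> \<Gamma>"
    using maximal_consequence[OF Or.prems, of "[Or \<phi> \<psi>, Neg \<phi>]" \<psi>]
      maximal_consequence[OF Or.prems, of "[\<phi>]" "Or \<phi> \<psi>"]
      maximal_consequence[OF Or.prems, of "[\<psi>]" "Or \<phi> \<psi>"] maximal_Neg[OF Or.prems, of \<phi>] by auto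
  with Or show ?case
    by auto
next
  case (Imp \<phi> \<psi>)
  have "Imp \<phi> \<psi> \<in> \<Gamma> \<longleftrightarrow> (\<phi> \<in> \<Gamma> \<longrightarrow> \<psi> \<in> \<Gamma>)"
    using maximal_consequence[OF Imp.prems, of "[Imp \<phi> \<psi>, \<phi>]" \<psi>]
      maximal_consequence[OF Imp.prems, of "[Neg \<phi>]" "Imp \<phi> \<psi>"]
      maximal_consequence[OF Imp.prems, of "[\<psi>]" "Imp \<phi> \<psi>"] maximal_Neg[OF Imp.prems, of \<phi>] by auto
  with Imp show ?case
    by auto
next
  case (Dia \<phi>)
  show ?case
  proof
    assume "canonical_sat \<Gamma> (Dia \<phi>)"
    then show "Dia \<phi> \<in> \<Gamma>"
      using Dia.IH unfolding canonical_rel_def canonical_worlds_def by auto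
  next
    assume "Dia \<phi> \<in> \<Gamma>"
    \<comment> \<open>The list consists of copies of \<open>\<phi>\<close> and may be empty, so
      \<open>\<phi>\<close> implies its conjunction.\<close>
    have "Dia (big_conj \<chi>s) \<in> \<Gamma>" if "set \<chi>s \<subseteq> {\<phi>}" for \<chi>s
    proof -
      have "Imp \<phi> (big_conj \<chi>s) \<in> L"
        using that by (intro logic_consequence[of "[]"]) (auto simp: prop_eval_big_conj)
      then show ?thesis
        using logic_Dia_mono maximal_mp[OF Dia.prems] \<open>Dia \<phi> \<in> \<Gamma>\<close> by blast
    qed
    then obtain \<Delta> where "{\<phi>} \<subseteq> \<Delta>" "(\<Gamma>, \<Delta>) \<in> canonical_rel L"
      using canonical_successor[OF Dia.prems, of "{\<phi>}"] by blast
    then show "canonical_sat \<Gamma> (Dia \<phi>)"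
      using Dia.IH unfolding canonical_rel_def canonical_worlds_def by auto
  qed
qed auto

section \<open>Paths in the canonical frame and their description by formulas\<close>

lemma canonical_rel_worlds: "canonical_rel L \<subseteq> canonical_worlds L \<times> canonical_worlds L"
  unfolding canonical_rel_def by blast

lemma canonical_relpow_maximal:
  "maximal L \<Gamma> \<Longrightarrow> (\<Gamma>, \<Delta>) \<in> canonical_rel L ^^ i \<Longrightarrow> maximal L \<Delta>"
  using relpow_closed[OF canonical_rel_worlds] unfolding canonical_worlds_def by blast

lemma maximal_Dia_pow:
  assumes "maximal L \<Gamma>"
  shows "(Dia ^^ i) \<phi> \<in> \<Gamma> \<longleftrightarrow> (\<exists>\<Delta>. (\<Gamma>, \<Delta>) \<in> canonical_rel L ^^ i \<and> \<phi> \<in> \<Delta>)"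
proof -
  have "canonical_sat \<Gamma> ((Dia ^^ i) \<phi>) \<longleftrightarrow>
      (\<exists>\<Delta>. (\<Gamma>, \<Delta>) \<in> canonical_rel L ^^ i \<and> canonical_sat \<Delta> \<phi>)"
    using assms by (intro sat_Dia_pow canonical_rel_worlds) (simp add: canonical_worlds_def)
  then show ?thesis
    using truth_lemma canonical_relpow_maximal assms by blast
qed

lemma maximal_dia_le:
  assumes "maximal L \<Gamma>"
  shows "dia_le m \<phi> \<in> \<Gamma> \<longleftrightarrow> (\<exists>i\<le>m. \<exists>\<Delta>. (\<Gamma>, \<Delta>) \<in> canonical_rel L ^^ i \<and> \<phi> \<in> \<Delta>)"
proof -
  have "canonical_sat \<Gamma> (dia_le m \<phi>) \<longleftrightarrow>
      (\<exists>i\<le>m. \<exists>\<Delta>. (\<Gamma>, \<Delta>) \<in> canonical_rel L ^^ i \<and> canonical_sat \<Delta> \<phi>)"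
    using assms by (intro sat_dia_le canonical_rel_worlds) (simp add: canonical_worlds_def)
  then show ?thesis
    using truth_lemma canonical_relpow_maximal assms by blast
qed

lemma maximal_box_le:
  assumes "maximal L \<Gamma>"
  shows "box_le m \<phi> \<in> \<Gamma> \<longleftrightarrow> (\<forall>i\<le>m. \<forall>\<Delta>. (\<Gamma>, \<Delta>) \<in> canonical_rel L ^^ i \<longrightarrow> \<phi> \<in> \<Delta>)"
proof -
  have "canonical_sat \<Gamma> (box_le m \<phi>) \<longleftrightarrow>
      (\<forall>i\<le>m. \<forall>\<Delta>. (\<Gamma>, \<Delta>) \<in> canonical_rel L ^^ i \<longrightarrow> canonical_sat \<Delta> \<phi>)"
    using assms by (intro sat_box_le canonical_rel_worlds) (simp add: canonical_worlds_def)
  then show ?thesis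
    using truth_lemma canonical_relpow_maximal assms by blast
qed

text \<open>The first world of the path is built as a successor of \<Gamma> containing
  \<open>(Dia ^^ i)\<close> applied to all members of \<Delta>; the induction hypothesis continues
  from it to \<Delta>.\<close>

lemma canonical_relpowI:
  assumes "maximal L \<Gamma>" "maximal L \<Delta>" "(Dia ^^ i) ` \<Delta> \<subseteq> \<Gamma>"
  shows "(\<Gamma>, \<Delta>) \<in> canonical_rel L ^^ i"
  using assms(1,3)
proof (induction i arbitrary: \<Gamma>)
  case 0
  then have "\<Delta> \<subseteq> \<Gamma>"
    by simp
  then have "\<Delta> = \<Gamma>"
    using 0(1) assms(2) unfolding maximal_def by blast
  then show ?case
    by simp
next
  case (Suc i)
  have "Dia (big_conj \<chi>s) \<in> \<Gamma>" if "set \<chi>s \<subseteq> (Dia ^^ i) ` \<Delta>" for \<chi>s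
  proof -
    have "\<chi>s \<in> map (Dia ^^ i) ` lists \<Delta>"
      using that lists_image[of "Dia ^^ i" \<Delta>] by (metis in_listsI subsetD)
    then obtain \<phi>s where \<phi>s: "set \<phi>s \<subseteq> \<Delta>" "\<chi>s = map (Dia ^^ i) \<phi>s"
      by (elim imageE) (simp only: lists_eq_set mem_Collect_eq)
    \<comment> \<open>Taking the conjunction before applying the diamonds yields one path whose end
      satisfies every member of \<open>\<phi>s\<close>; its first world then contains all of
      \<open>\<chi>s\<close> at once.\<close>
    have "(Dia ^^ Suc i) (big_conj \<phi>s) \<in> \<Gamma>"
      using Suc.prems(2) \<phi>s(1) maximal_big_conj[OF assms(2)] by blast
    then obtain \<Theta> where "(\<Gamma>, \<Theta>) \<in> canonical_rel L ^^ Suc i" "big_conj \<phi>s \<in> \<Theta>"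
      using maximal_Dia_pow[OF Suc.prems(1)] by blast
    then obtain \<Lambda> where \<Lambda>: "(\<Gamma>, \<Lambda>) \<in> canonical_rel L" "(\<Lambda>, \<Theta>) \<in> canonical_rel L ^^ i"
      by (meson relpow_Suc_E2)
    then have "maximal L \<Lambda>" "maximal L \<Theta>"
      using canonical_relpow_maximal unfolding canonical_rel_def canonical_worlds_def by auto
    then have "set \<phi>s \<subseteq> \<Theta>" "(Dia ^^ i) ` \<Theta> \<subseteq> \<Lambda>"
      using \<Lambda>(2) \<open>big_conj \<phi>s \<in> \<Theta>\<close> maximal_big_conj maximal_Dia_pow by blast+
    then have "set \<chi>s \<subseteq> \<Lambda>"
      using \<phi>s(2) by auto
    then show ?thesis
      using \<Lambda>(1) \<open>maximal L \<Lambda>\<close> maximal_big_conj unfolding canonical_rel_def by blast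
  qed
  then obtain \<Lambda> where \<Lambda>: "(Dia ^^ i) ` \<Delta> \<subseteq> \<Lambda>" "(\<Gamma>, \<Lambda>) \<in> canonical_rel L"
    using canonical_successor[OF Suc.prems(1)] by blast
  then have "(\<Lambda>, \<Delta>) \<in> canonical_rel L ^^ i"
    using Suc.IH unfolding canonical_rel_def canonical_worlds_def by blast
  with \<Lambda>(2) show ?case
    by (rule relpow_Suc_I2)
qed

text \<open>Each length up to \<open>m\<close> has its own witness by the contrapositive of
  \<open>canonical_relpowI\<close>; the conjunction of these finitely many witnesses serves all
  lengths.\<close>

lemma canonical_separation:
  assumes "maximal L \<Gamma>" "maximal L \<Delta>" "\<And>i. i \<le> m \<Longrightarrow> (\<Gamma>, \<Delta>) \<notin> canonical_rel L ^^ i"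
  obtains \<phi> where "\<phi> \<in> \<Delta>" "dia_le m \<phi> \<notin> \<Gamma>"
proof -
  have "\<forall>i\<in>{..m}. \<exists>\<phi>\<in>\<Delta>. (Dia ^^ i) \<phi> \<notin> \<Gamma>"
    using canonical_relpowI[OF assms(1,2)] assms(3) by blast
  then obtain f where f: "\<And>i. i \<le> m \<Longrightarrow> f i \<in> \<Delta> \<and> (Dia ^^ i) (f i) \<notin> \<Gamma>"
    by (metis atMost_iff)
  let ?\<phi> = "big_conj (map f [0..<Suc m])"
  have "?\<phi> \<in> \<Delta>"
    using f maximal_big_conj[OF assms(2)] by (auto simp del: upt_Suc)
  moreover have "dia_le m ?\<phi> \<notin> \<Gamma>"
  proof
    assume "dia_le m ?\<phi> \<in> \<Gamma>"
    then obtain i \<Theta> where \<Theta>: "i \<le> m" "(\<Gamma>, \<Theta>) \<in> canonical_rel L ^^ i" "?\<phi> \<in> \<Theta>"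
      using maximal_dia_le[OF assms(1)] by blast
    then have "set (map f [0..<Suc m]) \<subseteq> \<Theta>"
      using maximal_big_conj canonical_relpow_maximal[OF assms(1)] by blast
    then have "f i \<in> \<Theta>"
      using \<Theta>(1) by (auto simp del: upt_Suc)
    then show False
      using f[OF \<Theta>(1)] \<Theta>(2) maximal_Dia_pow[OF assms(1)] by blast
  qed
  ultimately show thesis
    by (rule that)
qed

text \<open>The axiom makes \<open>box_le m\<close> behave like the box of a transitive relation: a
  counterexample seen from \<Delta> is at most \<open>m + 1\<close> steps from \<Gamma>, and the
  axiom shortens the extreme case.\<close>

lemma maximal_box_le_step:
  assumes "transitivity_ax m \<in> L" "(\<Gamma>, \<Delta>) \<in> canonical_rel L" "box_le m \<psi> \<in> \<Gamma>"
  shows "box_le m \<psi> \<in> \<Delta>"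
proof (rule ccontr)
  assume "box_le m \<psi> \<notin> \<Delta>"
  have max: "maximal L \<Gamma>" "maximal L \<Delta>"
    using assms(2) unfolding canonical_rel_def canonical_worlds_def by auto
  then obtain i \<Theta> where \<Theta>: "i \<le> m" "(\<Delta>, \<Theta>) \<in> canonical_rel L ^^ i" "\<psi> \<notin> \<Theta>"
    using maximal_box_le \<open>box_le m \<psi> \<notin> \<Delta>\<close> by blast
  have path: "(\<Gamma>, \<Theta>) \<in> canonical_rel L ^^ Suc i"
    using assms(2) \<Theta>(2) by (rule relpow_Suc_I2)
  then have "Neg \<psi> \<in> \<Theta>"
    using \<Theta>(3) maximal_Neg canonical_relpow_maximal[OF max(1)] by blast
  have "dia_le m (Neg \<psi>) \<in> \<Gamma>"
  proof (cases "i = m")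
    case True
    have "Imp ((Dia ^^ Suc m) (Neg \<psi>)) (dia_le m (Neg \<psi>)) \<in> L"
      using logic_subst[OF assms(1), of "\<lambda>_. Neg \<psi>"] unfolding transitivity_ax_def
      by (simp add: subst_Dia_pow subst_dia_le)
    moreover have "(Dia ^^ Suc m) (Neg \<psi>) \<in> \<Gamma>"
      using path True \<open>Neg \<psi> \<in> \<Theta>\<close> maximal_Dia_pow[OF max(1)] by blast
    ultimately show ?thesis
      using maximal_mp[OF max(1)] by blast
  next
    case False
    then have "Suc i \<le> m"
      using \<Theta>(1) by simp
    then show ?thesis
      using path \<open>Neg \<psi> \<in> \<Theta>\<close> maximal_dia_le[OF max(1)] by blast
  qed
  then show False
    using assms(3) max maximal_dia_le maximal_box_le maximal_Neg canonical_relpow_maximal by meson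
qed

section \<open>The height axioms\<close>

text \<open>No variable with index above \<open>h\<close> occurs in the axiom, so the next one can
  be assigned freely.\<close>

lemma height_ax_vars:
  assumes "\<And>n. n \<le> h \<Longrightarrow> \<sigma> n = \<tau> n"
  shows "subst \<sigma> (height_ax h m) = subst \<tau> (height_ax h m)"
  using assms by (induction h m rule: height_ax.induct) (auto simp: subst_dia_le subst_box_le)

text \<open>The valuation is arbitrary, but its failure only matters through worlds that do not see
  each other in at most \<open>m\<close> steps. Separating formulas witness this, and they replace
  the variables from the outermost one inwards.\<close>

lemma canonical_height_ax_refuted:
  assumes "h \<ge> 1" "maximal L \<Gamma>"
    and "\<not> sat (canonical_worlds L) (canonical_rel L) V \<Gamma> (height_ax h m)"
  shows "\<exists>\<sigma>. subst \<sigma> (height_ax h m) \<notin> \<Gamma>"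
  using assms
proof (induction h m arbitrary: \<Gamma> rule: height_ax.induct)
  case (1 m)
  then show ?case
    by simp
next
  case (2 m)
  have W: "\<Theta> \<in> canonical_worlds L \<longleftrightarrow> maximal L \<Theta>" for \<Theta>
    by (simp add: canonical_worlds_def)
  obtain i \<Delta> where \<Delta>: "i \<le> m" "(\<Gamma>, \<Delta>) \<in> canonical_rel L ^^ i"
    "\<not> sat (canonical_worlds L) (canonical_rel L) V \<Delta> (dia_le m (Var 1))" "\<Gamma> \<in> V 1"
    using "2.prems" by (auto simp: sat_box_le[OF canonical_rel_worlds] W)
  have max: "maximal L \<Delta>"
    using canonical_relpow_maximal "2.prems" \<Delta> by blast
  \<comment> \<open>A short path back to \<Gamma>, which lies in \<open>V 1\<close>, would make
    \<open>dia_le m (Var 1)\<close> true at \<Delta>.\<close>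
  then have "\<And>j. j \<le> m \<Longrightarrow> (\<Delta>, \<Gamma>) \<notin> canonical_rel L ^^ j"
    using \<Delta> by (auto simp: sat_dia_le[OF canonical_rel_worlds] W)
  then obtain \<phi> where \<phi>: "\<phi> \<in> \<Gamma>" "dia_le m \<phi> \<notin> \<Delta>"
    using canonical_separation max "2.prems"(2) by blast
  have "Imp \<phi> (box_le m (dia_le m \<phi>)) \<notin> \<Gamma>"
    using \<phi> \<Delta>(1,2) maximal_mp[OF "2.prems"(2)] maximal_box_le[OF "2.prems"(2)] by blast
  then show ?case
    by (intro exI[of _ "\<lambda>_. \<phi>"]) (simp add: subst_dia_le subst_box_le)
next
  case (3 h m)
  let ?p = "Suc (Suc h)"
  have W: "\<Theta> \<in> canonical_worlds L \<longleftrightarrow> maximal L \<Theta>" for \<Theta>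
    by (simp add: canonical_worlds_def)
  obtain i \<Delta> where \<Delta>: "i \<le> m" "(\<Gamma>, \<Delta>) \<in> canonical_rel L ^^ i"
    "\<not> sat (canonical_worlds L) (canonical_rel L) V \<Delta> (dia_le m (Var ?p))"
    "\<not> sat (canonical_worlds L) (canonical_rel L) V \<Delta> (height_ax (Suc h) m)" "\<Gamma> \<in> V ?p"
    using "3.prems" by (auto simp: sat_box_le[OF canonical_rel_worlds] W)
  have max: "maximal L \<Delta>"
    using canonical_relpow_maximal "3.prems" \<Delta> by blast
  then have "\<And>j. j \<le> m \<Longrightarrow> (\<Delta>, \<Gamma>) \<notin> canonical_rel L ^^ j"
    using \<Delta> by (auto simp: sat_dia_le[OF canonical_rel_worlds] W)
  then obtain \<phi> where \<phi>: "\<phi> \<in> \<Gamma>" "dia_le m \<phi> \<notin> \<Delta>"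
    using canonical_separation max "3.prems"(2) by blast
  obtain \<sigma> where "subst \<sigma> (height_ax (Suc h) m) \<notin> \<Delta>"
    using "3.IH" max \<Delta>(4) by auto
  \<comment> \<open>The variable with index \<open>?p\<close> does not occur in the inner axiom, so
    redefining it keeps the failure at \<Delta>.\<close>
  then have \<sigma>: "subst (\<sigma>(?p := \<phi>)) (height_ax (Suc h) m) \<notin> \<Delta>" (is "?\<psi> \<notin> \<Delta>")
    using height_ax_vars[of "Suc h" "\<sigma>(?p := \<phi>)" \<sigma>] by simp
  have "Or (dia_le m \<phi>) ?\<psi> \<notin> \<Delta>"
    using \<phi>(2) \<sigma> truth_lemma[OF max] by (metis sat.simps(6))
  then have "Imp \<phi> (box_le m (Or (dia_le m \<phi>) ?\<psi>)) \<notin> \<Gamma>"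
    using \<phi>(1) \<Delta>(1,2) maximal_mp[OF "3.prems"(2)] maximal_box_le[OF "3.prems"(2)] by blast
  then show ?case
    by (intro exI[of _ "\<sigma>(?p := \<phi>)"]) (simp add: subst_dia_le subst_box_le fun_upd_def)
qed

text \<open>Every maximal set contains all substitution instances of the axiom, whereas a refuting
  valuation would exclude one of them.\<close>

lemma canonical_frame_validates_height_ax:
  assumes "h \<ge> 1" "height_ax h m \<in> L"
  shows "valid (canonical_worlds L) (canonical_rel L) (height_ax h m)"
  unfolding valid_def
  using assms canonical_height_ax_refuted logic_subst maximal_superset
  by (metis canonical_worlds_def mem_Collect_eq subsetD)

section \<open>Transfer of validity to subframes of the canonical frame\<close>

lemma canonical_generated_subframe:
  assumes "canonical L" "\<phi> \<in> L" "W \<subseteq> canonical_worlds L"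
    and "\<And>\<Gamma> \<Delta>. \<Gamma> \<in> W \<Longrightarrow> (\<Gamma>, \<Delta>) \<in> canonical_rel L \<Longrightarrow> \<Delta> \<in> W"
    and "\<And>\<Gamma> \<Delta>. \<Gamma> \<in> W \<Longrightarrow> \<Delta> \<in> W \<Longrightarrow> (\<Gamma>, \<Delta>) \<in> R \<longleftrightarrow> (\<Gamma>, \<Delta>) \<in> canonical_rel L"
  shows "valid W R \<phi>"
  by (rule valid_generated_subframe[of "canonical_worlds L" "canonical_rel L"])
    (use assms in \<open>auto simp: canonical_def\<close>)

text \<open>The worlds of \<open>K\<close> are exactly the worlds of \<open>L\<close> that include
  \<open>K\<close>, and they are closed under successors because \<open>K\<close> is closed under
  necessitation.\<close>

lemma extension_validates:
  assumes "canonical L" "normal_logic K" "L \<subseteq> K" "\<phi> \<in> L"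
  shows "valid (canonical_worlds K) (canonical_rel K) \<phi>"
proof -
  interpret K: normal_modal_logic K
    by unfold_locales (rule assms)
  have worlds: "\<Gamma> \<in> canonical_worlds K \<longleftrightarrow> maximal L \<Gamma> \<and> K \<subseteq> \<Gamma>" for \<Gamma>
  proof
    assume "\<Gamma> \<in> canonical_worlds K"
    then have "maximal K \<Gamma>"
      by (simp add: canonical_worlds_def)
    moreover from this have "\<not> inconsistent L \<Gamma>"
      using assms(3) unfolding maximal_def inconsistent_def by blast
    ultimately show "maximal L \<Gamma> \<and> K \<subseteq> \<Gamma>"
      using K.maximal_superset K.maximal_Neg maximal_iff by blast
  next
    assume *: "maximal L \<Gamma> \<and> K \<subseteq> \<Gamma>"
    \<comment> \<open>A refutation in \<open>K\<close> would put both a conjunction of members of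
      \<Gamma> and its negation into \<Gamma>.\<close>
    have "\<not> inconsistent K \<Gamma>"
      using * maximal_Neg maximal_big_conj unfolding inconsistent_def by blast
    then show "\<Gamma> \<in> canonical_worlds K"
      using * maximal_iff K.maximal_iff by (simp add: canonical_worlds_def)
  qed
  show ?thesis
  proof (rule canonical_generated_subframe[OF assms(1,4)])
    show "\<Delta> \<in> canonical_worlds K"
      if "\<Gamma> \<in> canonical_worlds K" "(\<Gamma>, \<Delta>) \<in> canonical_rel L" for \<Gamma> \<Delta>
    proof -
      have max: "maximal L \<Gamma>" "K \<subseteq> \<Gamma>" "maximal L \<Delta>" "Dia ` \<Delta> \<subseteq> \<Gamma>"
        using that worlds unfolding canonical_rel_def canonical_worlds_def by auto
      have "\<psi> \<in> \<Delta>" if "\<psi> \<in> K" for \<psi>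
      proof (rule ccontr)
        assume "\<psi> \<notin> \<Delta>"
        then have "Dia (Neg \<psi>) \<in> \<Gamma>"
          using max maximal_Neg by blast
        \<comment> \<open>Necessitation in terms of \<open>Dia\<close>: monotonicity turns this into
          an implication from \<open>Dia (Neg \<psi>)\<close> to \<open>Dia Bot\<close>, which no
          world contains.\<close>
        moreover have "Imp (Neg \<psi>) Bot \<in> K"
          by (rule K.logic_consequence[of "[\<psi>]"]) (use that in auto)
        then have "Imp (Dia (Neg \<psi>)) (Dia Bot) \<in> \<Gamma>"
          using K.logic_Dia_mono max(2) by blast
        ultimately show False
          using maximal_mp[OF max(1)] maximal_Dia_Bot[OF max(1)] by blast
      qed
      then show ?thesis
        using max(3) worlds by blast
    qed
  qed (use worlds in \<open>auto simp: canonical_rel_def canonical_worlds_def\<close>)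
qed

section \<open>Consistency, by soundness on a frame with one cluster\<close>

lemma height_consistent:
  assumes "canonical L" "transitivity_ax m \<in> L" "h \<ge> 1"
  shows "Bot \<notin> logic_sum L {height_ax h m}"
proof -
  have "\<not> inconsistent L {}"
  proof
    assume "inconsistent L {}"
    then have "Neg Top \<in> L"
      unfolding inconsistent_def by auto
    then have "Bot \<in> L"
      by (intro logic_consequence[of "[Neg Top]"]) auto
    then show False
      using assms(1) unfolding canonical_def consistent_logic_def by blast
  qed
  then obtain S where S: "S \<subseteq> range (box_le m)" "\<not> inconsistent L S"
    "\<And>T. T \<subseteq> range (box_le m) \<Longrightarrow> S \<subset> T \<Longrightarrow> inconsistent L T"
    using lindenbaum_within[of "{}" "range (box_le m)" L] by (metis empty_subsetI)
  \<comment> \<open>By the choice of \<open>S\<close>, all worlds that include it contain the same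
    formulas of the form \<open>box_le m \<psi>\<close>, namely those in \<open>S\<close>.\<close>
  have S_box: "box_le m \<psi> \<in> S" if "maximal L \<Gamma>" "S \<subseteq> \<Gamma>" "box_le m \<psi> \<in> \<Gamma>" for \<Gamma> \<psi>
  proof (rule ccontr)
    assume "box_le m \<psi> \<notin> S"
    then have "inconsistent L (insert (box_le m \<psi>) S)"
      using S(1) by (intro S(3)) auto
    then have "inconsistent L \<Gamma>"
      using that(2,3) unfolding inconsistent_def by blast
    then show False
      using that(1) unfolding maximal_def by blast
  qed
  define W where "W = {\<Gamma>. maximal L \<Gamma> \<and> S \<subseteq> \<Gamma>}"
  define R where "R = canonical_rel L \<inter> W \<times> W"
  have step: "\<Delta> \<in> W" if "\<Gamma> \<in> W" "(\<Gamma>, \<Delta>) \<in> canonical_rel L" for \<Gamma> \<Delta>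
  proof -
    have "\<psi> \<in> \<Delta>" if "\<psi> \<in> S" for \<psi>
      using that S(1) \<open>\<Gamma> \<in> W\<close> \<open>(\<Gamma>, \<Delta>) \<in> canonical_rel L\<close> maximal_box_le_step[OF assms(2)]
      unfolding W_def by blast
    then show ?thesis
      using that(2) unfolding W_def canonical_rel_def canonical_worlds_def by blast
  qed
  \<comment> \<open>Canonical paths that start in \<open>W\<close> never leave it, so restricting
    the relation to \<open>W\<close> loses none of them.\<close>
  have W_path: "(\<Gamma>, \<Delta>) \<in> R ^^ i" if "\<Gamma> \<in> W" "(\<Gamma>, \<Delta>) \<in> canonical_rel L ^^ i" for \<Gamma> \<Delta> i
    using that
  proof (induction i arbitrary: \<Gamma>)
    case (Suc i)
    then obtain \<Theta> where "(\<Gamma>, \<Theta>) \<in> canonical_rel L" "(\<Theta>, \<Delta>) \<in> canonical_rel L ^^ i"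
      by (meson relpow_Suc_E2)
    then show ?case
      using Suc step unfolding R_def by (meson IntI SigmaI relpow_Suc_I2)
  qed simp
  have cluster: "\<exists>i\<le>m. (\<Gamma>, \<Delta>) \<in> R ^^ i" if "\<Gamma> \<in> W" "\<Delta> \<in> W" for \<Gamma> \<Delta>
  proof (rule ccontr)
    assume "\<not> ?thesis"
    then have unseen: "\<And>i. i \<le> m \<Longrightarrow> (\<Gamma>, \<Delta>) \<notin> canonical_rel L ^^ i"
      using W_path that(1) by blast
    have max: "maximal L \<Gamma>" "S \<subseteq> \<Gamma>" "maximal L \<Delta>" "S \<subseteq> \<Delta>"
      using that unfolding W_def by auto
    obtain \<phi> where \<phi>: "\<phi> \<in> \<Delta>" "dia_le m \<phi> \<notin> \<Gamma>"
      using canonical_separation[OF max(1,3) unseen] by blast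
    \<comment> \<open>The separating formula fails throughout what \<Gamma> sees in at most
      \<open>m\<close> steps. This boxed fact passes to \<Delta> through \<open>S\<close>, and its
      instance with zero steps contradicts \<open>\<phi> \<in> \<Delta>\<close>.\<close>
    then have "box_le m (Neg \<phi>) \<in> \<Gamma>"
      using max(1) maximal_box_le maximal_dia_le maximal_Neg canonical_relpow_maximal by meson
    then have "box_le m (Neg \<phi>) \<in> \<Delta>"
      using S_box max by blast
    then have "Neg \<phi> \<in> \<Delta>"
      using max(3) maximal_box_le[of \<Delta>] by (metis le0 relpow_0_I)
    with \<phi>(1) show False
      using max(3) maximal_Neg by blast
  qed
  have "valid W R \<phi>" if "\<phi> \<in> L" for \<phi>
  proof (rule canonical_generated_subframe[OF assms(1) that])
    show "W \<subseteq> canonical_worlds L"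
      unfolding W_def canonical_worlds_def by blast
  qed (use step in \<open>simp_all add: R_def\<close>)
  moreover have "valid W R (height_ax h m)"
    by (rule height_ax_valid) (use assms(3) cluster in \<open>auto simp: R_def\<close>)
  ultimately have "logic_sum L {height_ax h m} \<subseteq> {\<phi>. valid W R \<phi>}"
    by (intro logic_sum_least normal_logic_valid) auto
  \<comment> \<open>Since \<open>S\<close> is consistent, some world extends it and \<open>W\<close>
    is nonempty.\<close>
  moreover have "\<not> valid W R Bot"
  proof -
    obtain \<Gamma> where "S \<subseteq> \<Gamma>" "maximal L \<Gamma>"
      using lindenbaum[OF S(2)] by blast
    then have "\<Gamma> \<in> W"
      unfolding W_def by blast
    then show ?thesis
      unfolding valid_def by auto
  qed
  ultimately show ?thesis
    by blast
qed

end

theorem theorem4: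
  fixes L :: "fm set" and h :: nat
  assumes "normal_logic L"
    and "pretransitive L"
    and "canonical L"
    and "h \<ge> 1"
  shows "canonical (logic_height L h)"
proof -
  interpret normal_modal_logic L
    by unfold_locales (rule assms)
  define K where "K = logic_height L h"
  have K: "normal_logic K" "L \<subseteq> K" "height_ax h (tr L) \<in> K"
    using normal_logic_logic_sum logic_sum_upper unfolding K_def logic_height_def by blast+
  interpret K: normal_modal_logic K
    by unfold_locales (rule K)
  let ?V = "{\<phi>. valid (canonical_worlds K) (canonical_rel K) \<phi>}"
  have "transitivity_ax (tr L) \<in> L"
    using assms(2) unfolding pretransitive_def tr_def by (rule LeastI_ex)
  then have "consistent_logic K"
    using height_consistent assms(3,4)
    unfolding consistent_logic_def K_def logic_height_def by blast
  \<comment> \<open>Both kinds of generators of \<open>K\<close> are valid in its canonical frame;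
    as the valid formulas form a normal logic, all of \<open>K\<close> is valid there.\<close>
  moreover have "L \<union> {height_ax h (tr L)} \<subseteq> ?V"
    using extension_validates[OF assms(3) K(1,2)]
      K.canonical_frame_validates_height_ax[OF assms(4) K(3)] by blast
  then have "K \<subseteq> ?V"
    unfolding K_def logic_height_def by (intro logic_sum_least normal_logic_valid)
  ultimately show ?thesis
    unfolding canonical_def K_def by blast
qed

end
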